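(* Let $K$ be a first-countable compact Hausdorff space. Suppose that for every positive continuous interval $A$ in $C(K)$ and every nonnegative continuous interval $B$ in $C(K)$ the product $A\cdot B$ is a closed subset of $C(K)$. Then $K$ is finite.
   Context: $C(K)$ is the Banach algebra of continuous real functions on $K$ with the supremum norm; closedness is with respect to this norm. For $A,B\subset C(K)$, $A\cdot B=\{ab: a\in A,\ b\in B\}$ with pointwise products. An interval in $C(K)$ is a set of the form $[f,g]=\{h\in C(K): f\le h\le g\}$, where $f,g:K\to\mathbb{R}$ are bounded functions (not necessarily continuous) and inequalities between functions are pointwise; such a pair $f,g$ is called a representation of the interval. An interval is positive (respectively nonnegative) if it has a representation $[f,g]$ with $f>0$ (respectively $f\ge 0$) pointwise on $K$. An interval is continuous if it has a representation $[f,g]$ with $f,g$ continuous. *)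

theory Defs
  imports "HOL-Analysis.Analysis"
begin

text \<open>
  The space \<open>C(K)\<close> is rendered as \<^typ>\<open>'a \<Rightarrow>\<^sub>C real\<close>, the bounded continuous functions with the
  supremum metric; when \<open>K\<close> (the whole type \<open>'a\<close>) is compact, boundedness is automatic, so these
  are all the continuous functions. The library provides no multiplication on this type.
\<close>

definition bcontfun_mult ::
    "('a::topological_space \<Rightarrow>\<^sub>C real) \<Rightarrow> ('a \<Rightarrow>\<^sub>C real) \<Rightarrow> ('a \<Rightarrow>\<^sub>C real)"
  where "bcontfun_mult f g = Bcontfun (\<lambda>x. f x * g x)"

lemma apply_bcontfun_mult [simp]:
  fixes f g :: "'a::topological_space \<Rightarrow>\<^sub>C real"
  shows "apply_bcontfun (bcontfun_mult f g) x = f x * g x"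
proof -
  obtain M N where MN: "\<And>x. \<bar>f x\<bar> \<le> M" "\<And>x. \<bar>g x\<bar> \<le> N"
    using bounded_apply_bcontfun[of f] bounded_apply_bcontfun[of g]
    by (auto simp: bounded_iff)
  have "\<bar>f x * g x\<bar> \<le> M * N" for x
    using mult_mono[OF MN(1)[of x] MN(2)[of x]] order_trans[OF abs_ge_zero MN(1)[of x]]
    by (simp add: abs_mult)
  then have "bounded (range (\<lambda>x. f x * g x))"
    by (auto simp: bounded_iff)
  then have "(\<lambda>x. f x * g x) \<in> bcontfun"
    by (auto simp: bcontfun_def intro!: continuous_on_mult)
  then show ?thesis
    by (simp add: bcontfun_mult_def Bcontfun_inverse)
qed

definition setprod_C ::
    "('a::topological_space \<Rightarrow>\<^sub>C real) set \<Rightarrow> ('a \<Rightarrow>\<^sub>C real) set \<Rightarrow> ('a \<Rightarrow>\<^sub>C real) set"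
  where "setprod_C A B = {bcontfun_mult a b |a b. a \<in> A \<and> b \<in> B}"

definition interval_C ::
    "('a::topological_space \<Rightarrow> real) \<Rightarrow> ('a \<Rightarrow> real) \<Rightarrow> ('a \<Rightarrow>\<^sub>C real) set"
  where "interval_C f g = {h. f \<le> apply_bcontfun h \<and> apply_bcontfun h \<le> g}"

text \<open>
  The same set may have many representations. The properties below are properties of the set, each
  asking for some representation of its own; the witnesses for two different properties of one
  interval need not coincide. Nothing requires \<open>f \<le> g\<close>, so an interval may be empty.
\<close>

definition represents_interval ::
    "('a::topological_space \<Rightarrow> real) \<Rightarrow> ('a \<Rightarrow> real) \<Rightarrow> ('a \<Rightarrow>\<^sub>C real) set \<Rightarrow> bool"
  where "represents_interval f g A \<longleftrightarrow>
    bounded (range f) \<and> bounded (range g) \<and> A = interval_C f g"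

definition positive_interval :: "('a::topological_space \<Rightarrow>\<^sub>C real) set \<Rightarrow> bool"
  where "positive_interval A \<longleftrightarrow> (\<exists>f g. represents_interval f g A \<and> (\<forall>x. 0 < f x))"

definition nonnegative_interval :: "('a::topological_space \<Rightarrow>\<^sub>C real) set \<Rightarrow> bool"
  where "nonnegative_interval A \<longleftrightarrow> (\<exists>f g. represents_interval f g A \<and> (\<forall>x. 0 \<le> f x))"

definition continuous_interval :: "('a::topological_space \<Rightarrow>\<^sub>C real) set \<Rightarrow> bool"
  where "continuous_interval A \<longleftrightarrow>
    (\<exists>f g. represents_interval f g A \<and> continuous_on UNIV f \<and> continuous_on UNIV g)"

end

theory Submission
  imports Defs
begin

text \<open>
  If \<open>K\<close> is infinite it has a non-isolated point \<open>p\<close>, and first countability gives a continuous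
  \<open>\<phi> \<ge> 0\<close> vanishing exactly at \<open>p\<close>. Choose \<open>\<psi> : (0,\<infinity>) \<rightarrow> [1,2]\<close> continuous, such that \<open>\<psi> \<circ> \<phi>\<close>
  oscillates between 1 and 2 at \<open>p\<close>. Then \<open>\<phi> \<cdot> (\<psi> \<circ> \<phi>)\<close>, extended by 0 at \<open>p\<close>, is the uniform limit
  of \<open>\<phi> \<cdot> (\<psi> \<circ> max \<phi> \<epsilon>)\<close> as \<open>\<epsilon> \<rightarrow> 0\<close>, hence lies in the closure of \<open>[1,2] \<cdot> [\<phi>,\<phi>]\<close>; it does not lie in
  the product itself, since the factor from \<open>[1,2]\<close> would have to be \<open>\<psi> \<circ> \<phi>\<close> off \<open>p\<close>.
\<close>

lemma apply_Bcontfun_compact: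
  fixes f :: "'a::topological_space \<Rightarrow> 'b::real_normed_vector"
  assumes "compact (UNIV :: 'a set)" "continuous_on UNIV f"
  shows "apply_bcontfun (Bcontfun f) = f"
proof -
  have "bounded (range f)"
    using assms compact_continuous_image compact_imp_bounded by blast
  then have "f \<in> bcontfun"
    using assms by (simp add: bcontfun_def)
  then show ?thesis
    by (simp add: Bcontfun_inverse)
qed

text \<open>A compact Hausdorff space is normal, so Urysohn's lemma separates the closed sets
  \<open>{p}\<close> and \<open>- U\<close>.\<close>

lemma compact_t2_Urysohn_point:
  fixes p :: "'a::t2_space"
  assumes "compact (UNIV :: 'a set)" "open U" "p \<in> U"
  obtains f :: "'a \<Rightarrow> real" where "continuous_on UNIV f" "\<And>x. 0 \<le> f x" "\<And>x. f x \<le> 1"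
    "f p = 0" "\<And>x. x \<notin> U \<Longrightarrow> f x = 1"
proof -
  have "compact_space (euclidean :: 'a topology)"
    using assms by (simp add: compact_space_def)
  moreover have "Hausdorff_space (euclidean :: 'a topology)"
    by (simp add: Hausdorff_space_def disjnt_def) (metis separation_t2)
  ultimately have "normal_space (euclidean :: 'a topology)"
    using compact_Hausdorff_or_regular_imp_normal_space by blast
  moreover have "closedin euclidean {p}" "closedin euclidean (- U)" "disjnt {p} (- U)"
    using assms by auto
  ultimately obtain f where "continuous_map euclidean (top_of_set {0..1::real}) f"
    "f ` {p} \<subseteq> {0}" "f ` (- U) \<subseteq> {1}"
    using Urysohn_lemma[of euclidean "{p}" "- U" 0 "1::real"] by auto
  then have "continuous_on UNIV f" "\<And>x. f x \<in> {0..1}" "f p = 0" "\<And>x. x \<notin> U \<Longrightarrow> f x = 1"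
    by (auto simp: continuous_map_in_subtopology)
  then show thesis
    using that[of f] by auto
qed

text \<open>\<open>f\<close> is a weighted sum of Urysohn functions, one for each member of a
  countable neighbourhood base at \<open>p\<close>. A point other than \<open>p\<close> lies outside
  some member of the base, and the corresponding summand is positive there.\<close>

lemma compact_t2_first_countable_point_zero_set:
  fixes p :: "'a::{first_countable_topology, t2_space}"
  assumes K: "compact (UNIV :: 'a set)"
  obtains f :: "'a \<Rightarrow> real" where "continuous_on UNIV f" "f p = 0" "\<And>x. x \<noteq> p \<Longrightarrow> 0 < f x"
proof -
  obtain U :: "nat \<Rightarrow> 'a set" where U: "\<And>n. open (U n)" "\<And>n. p \<in> U n"
    "\<And>S. open S \<Longrightarrow> p \<in> S \<Longrightarrow> eventually (\<lambda>i. U i \<subseteq> S) sequentially"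
    using countable_basis_at_decseq[of p] by blast
  have "\<exists>f :: 'a \<Rightarrow> real. continuous_on UNIV f \<and> (\<forall>x. 0 \<le> f x \<and> f x \<le> 1) \<and> f p = 0 \<and>
      (\<forall>x. x \<notin> U n \<longrightarrow> f x = 1)" for n
    using compact_t2_Urysohn_point[OF K U(1) U(2)] by metis
  then obtain g :: "nat \<Rightarrow> 'a \<Rightarrow> real" where g: "\<And>n. continuous_on UNIV (g n)"
    "\<And>n x. 0 \<le> g n x" "\<And>n x. g n x \<le> 1" "\<And>n. g n p = 0" "\<And>n x. x \<notin> U n \<Longrightarrow> g n x = 1"
    by metis
  define f where "f x = (\<Sum>n. (1/2)^n * g n x)" for x
  have le: "norm ((1/2)^n * g n x) \<le> (1/2)^n" for n x
    using g(2,3)[of n x] by (simp add: abs_mult mult_left_le)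
  have summable: "summable (\<lambda>n. (1/2)^n * g n x)" for x
    by (rule summable_comparison_test'[OF _ le]) (simp add: summable_geometric)
  have "uniform_limit UNIV (\<lambda>n x. \<Sum>i<n. (1/2)^i * g i x) f sequentially"
    unfolding f_def by (rule Weierstrass_m_test[OF le]) (simp add: summable_geometric)
  then have "continuous_on UNIV f"
    by (rule uniform_limit_theorem[rotated])
      (auto intro!: continuous_intros g(1) always_eventually)
  moreover have "f p = 0"
    by (simp add: f_def g)
  moreover have "0 < f x" if "x \<noteq> p" for x
  proof -
    have "eventually (\<lambda>i. U i \<subseteq> - {x}) sequentially"
      using that by (intro U(3)) auto
    then obtain i where "x \<notin> U i"
      by (auto simp: eventually_sequentially)
    then have "0 < (1/2)^i * g i x"
      by (simp add: g)
    then show ?thesis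
      unfolding f_def using summable g(2) by (intro suminf_pos2[where i = i]) auto
  qed
  ultimately show thesis
    using that by blast
qed

text \<open>The set \<open>S\<close> will be the range of \<phi>. As the space may be disconnected,
  \<phi> can skip many small values, so a fixed formula such as one in sin(1/t) need not oscillate
  along it. The values 1 and 2 are therefore prescribed at points of \<open>S\<close>
  itself.\<close>

lemma oscillating_function_at_0:
  fixes S :: "real set"
  assumes S: "\<And>e. 0 < e \<Longrightarrow> \<exists>s\<in>S. 0 < s \<and> s < e"
  obtains f :: "real \<Rightarrow> real" where "continuous_on {0<..} f" "\<And>t. 0 < t \<Longrightarrow> f t \<in> {1..2}"
    "\<And>e. 0 < e \<Longrightarrow> \<exists>s\<in>S. 0 < s \<and> s < e \<and> f s = 1"
    "\<And>e. 0 < e \<Longrightarrow> \<exists>s\<in>S. 0 < s \<and> s < e \<and> f s = 2"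
proof -
  have "\<exists>t. \<forall>n. (t n \<in> S \<and> 0 < t n \<and> t n < inverse (real (Suc n))) \<and> t (Suc n) < t n"
  proof (rule dependent_nat_choice)
    show "\<exists>x. x \<in> S \<and> 0 < x \<and> x < inverse (real (Suc 0))"
      using S[of 1] by auto
  next
    fix x n assume "x \<in> S \<and> 0 < x \<and> x < inverse (real (Suc n))"
    then show "\<exists>y. (y \<in> S \<and> 0 < y \<and> y < inverse (real (Suc (Suc n)))) \<and> y < x"
      using S[of "min x (inverse (real (Suc (Suc n))))"] by auto
  qed
  then obtain t where t: "\<And>n. t n \<in> S" "\<And>n. 0 < t n" "\<And>n. t n < inverse (real (Suc n))"
    "\<And>n. t (Suc n) < t n"
    by blast
  have "inj t"
    using t(4) lift_Suc_mono_less[of "\<lambda>n. - t n"] by (auto intro!: linorder_injI) force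
  have lim: "t \<longlonglongrightarrow> 0"
    using t(2,3) by (intro tendsto_sandwich[OF _ _ tendsto_const LIMSEQ_inverse_real_of_nat])
      (auto intro!: always_eventually less_imp_le)
  \<comment> \<open>The only possible accumulation point of a subsequence is 0, which the half-line
    omits.\<close>
  have closedin: "closedin (top_of_set {0<..}) (range (t \<circ> r))" if "strict_mono r" for r :: "nat \<Rightarrow> nat"
  proof -
    have "compact (insert 0 (range (t \<circ> r)))"
      using LIMSEQ_subseq_LIMSEQ[OF lim that] by (rule compact_sequence_with_limit)
    moreover have "range (t \<circ> r) = {0<..} \<inter> insert 0 (range (t \<circ> r))"
      using t(2) by auto
    ultimately show ?thesis
      using closedin_closed compact_imp_closed by blast
  qed
  \<comment> \<open>Urysohn's lemma on the half-line makes the function 1 along the even terms and 2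
    along the odd ones.\<close>
  define even odd where "even = range (t \<circ> (\<lambda>n. 2 * n))" and "odd = range (t \<circ> (\<lambda>n. Suc (2 * n)))"
  have "closedin (top_of_set {0<..}) even" "closedin (top_of_set {0<..}) odd"
    unfolding even_def odd_def by (intro closedin; simp add: strict_mono_def)+
  moreover have "even \<inter> odd = {}"
    using \<open>inj t\<close> by (auto simp: even_def odd_def inj_eq) presburger
  ultimately obtain f where f: "continuous_on {0<..} f"
    "\<And>x. x \<in> {0<..} \<Longrightarrow> f x \<in> closed_segment 1 (2::real)"
    "\<And>x. x \<in> even \<Longrightarrow> f x = 1" "\<And>x. x \<in> odd \<Longrightarrow> f x = 2"
    using Urysohn_local[of "{0<..}" even odd 1 2] by metis
  have small: "\<exists>n. t (2 * n) < e \<and> t (Suc (2 * n)) < e" if "0 < e" for e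
  proof -
    obtain n where "inverse (real (Suc n)) < e"
      using reals_Archimedean[OF \<open>0 < e\<close>] by blast
    moreover have "inverse (real (Suc (2 * n))) \<le> inverse (real (Suc n))"
      by (intro le_imp_inverse_le) auto
    ultimately show ?thesis
      using t(3)[of "2 * n"] t(4)[of "2 * n"] by (intro exI[of _ n]) linarith
  qed
  show thesis
  proof (rule that[OF f(1)])
    show "f x \<in> {1..2}" if "0 < x" for x
      using f(2)[of x] that by (simp add: closed_segment_eq_real_ivl)
    show "\<exists>s\<in>S. 0 < s \<and> s < e \<and> f s = 1" if "0 < e" for e
      using small[OF that] t(1,2) f(3) by (force simp: even_def)
    show "\<exists>s\<in>S. 0 < s \<and> s < e \<and> f s = 2" if "0 < e" for e
      using small[OF that] t(1,2) f(4) by (force simp: odd_def)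
  qed
qed

text \<open>On the compact complement of \<open>V\<close> the function attains its minimum, which is
  positive because \<open>p\<close> is not there; this minimum serves as \<open>e\<close>. If
  \<open>V\<close> is everything there is no minimum to take, hence the case split.\<close>

lemma compact_point_zero_set_nhds:
  fixes f :: "'a::topological_space \<Rightarrow> real"
  assumes "compact (UNIV :: 'a set)" "continuous_on UNIV f" "\<And>x. x \<noteq> p \<Longrightarrow> 0 < f x"
    and "open V" "p \<in> V"
  obtains e where "0 < e" "\<And>x. f x < e \<Longrightarrow> x \<in> V"
proof (cases "V = UNIV")
  case True
  then show thesis
    using that[of 1] by simp
next
  case False
  have "compact (- V)"
    using assms compact_Int_closed[of UNIV "- V"] by (simp add: closed_Compl)
  then obtain y where "y \<in> - V" "\<And>x. x \<in> - V \<Longrightarrow> f y \<le> f x"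
    using continuous_attains_inf[of "- V" f] assms(2) False continuous_on_subset by blast
  then show thesis
    using that[of "f y"] assms(3,5) by force
qed

lemma not_closed_setprod_C:
  fixes p :: "'a::topological_space"
  assumes K: "compact (UNIV :: 'a set)" and p: "p islimpt UNIV"
    and \<phi>: "continuous_on UNIV \<phi>" "\<phi> p = 0" "\<And>x. x \<noteq> p \<Longrightarrow> 0 < \<phi> x"
  shows "\<not> closed (setprod_C (interval_C (\<lambda>_. 1) (\<lambda>_. 2)) (interval_C \<phi> \<phi>))"
    (is "\<not> closed ?P")
proof
  assume closed: "closed ?P"
  have \<phi>_nonneg: "0 \<le> \<phi> x" for x
    using \<phi>(2) \<phi>(3)[of x] by (cases "x = p") auto
  have small: "\<exists>s\<in>range \<phi>. 0 < s \<and> s < e" if "0 < e" for e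
  proof -
    have "open {x. \<phi> x < e}"
      using \<phi>(1) by (intro open_Collect_less continuous_on_const)
    then obtain x where "x \<noteq> p" "\<phi> x < e"
      using islimptE[OF p, of "{x. \<phi> x < e}"] \<phi>(2) \<open>0 < e\<close> by auto
    then show ?thesis
      using \<phi>(3) by blast
  qed
  obtain \<psi> :: "real \<Rightarrow> real" where \<psi>: "continuous_on {0<..} \<psi>" "\<And>t. 0 < t \<Longrightarrow> \<psi> t \<in> {1..2}"
    "\<And>e. 0 < e \<Longrightarrow> \<exists>s\<in>range \<phi>. 0 < s \<and> s < e \<and> \<psi> s = 1"
    "\<And>e. 0 < e \<Longrightarrow> \<exists>s\<in>range \<phi>. 0 < s \<and> s < e \<and> \<psi> s = 2"
    using oscillating_function_at_0[OF small] by blast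
  define d where "d n = inverse (real (Suc n))" for n
  have d: "0 < d n" for n
    by (simp add: d_def)
  \<comment> \<open>The cutoff at \<open>d n\<close> keeps the argument of \<psi> away from 0, so
    \<open>a n\<close> is continuous at \<open>p\<close> as well.\<close>
  define a where "a n = Bcontfun (\<lambda>x. \<psi> (max (\<phi> x) (d n)))" for n
  define b where "b = Bcontfun \<phi>"
  have a: "apply_bcontfun (a n) = (\<lambda>x. \<psi> (max (\<phi> x) (d n)))" for n
    unfolding a_def using \<phi>(1) d
    by (intro apply_Bcontfun_compact K continuous_on_compose2[OF \<psi>(1)] continuous_intros)
      (auto simp: less_max_iff_disj)
  have b: "apply_bcontfun b = \<phi>"
    unfolding b_def by (intro apply_Bcontfun_compact K \<phi>(1))
  have mem: "bcontfun_mult (a n) b \<in> ?P" for n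
  proof -
    have "a n \<in> interval_C (\<lambda>_. 1) (\<lambda>_. 2)"
      using \<psi>(2)[of "max (\<phi> _) (d n)"] d[of n]
      by (simp add: interval_C_def le_fun_def a less_max_iff_disj)
    moreover have "b \<in> interval_C \<phi> \<phi>"
      by (simp add: interval_C_def b)
    ultimately show ?thesis
      unfolding setprod_C_def by blast
  qed
  \<comment> \<open>Nothing is known about \<psi> at 0, but the factor \<phi> makes
    \<open>h p\<close> equal to 0 in any case.\<close>
  define h where "h x = \<phi> x * \<psi> (\<phi> x)" for x
  \<comment> \<open>The two functions differ only where \<phi> is below \<open>d n\<close>. Off
    \<open>p\<close>, two values of \<psi> in [1,2] differ by at most 1, so the error is at most
    \<phi> x.\<close>
  have dist_le: "dist (\<psi> (max (\<phi> x) (d n)) * \<phi> x) (h x) \<le> d n" for n x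
  proof (cases "\<phi> x < d n")
    case True
    show ?thesis
    proof (cases "x = p")
      case True
      then show ?thesis
        using d[of n] by (simp add: h_def \<phi>(2))
    next
      case False
      have "dist (\<psi> (max (\<phi> x) (d n)) * \<phi> x) (h x) = \<phi> x * \<bar>\<psi> (d n) - \<psi> (\<phi> x)\<bar>"
        using True \<phi>_nonneg[of x]
        by (simp add: h_def dist_real_def max_def abs_mult flip: right_diff_distrib mult.commute[of "\<phi> x"])
      also have "\<dots> \<le> \<phi> x * 1"
        using \<psi>(2)[OF d[of n]] \<psi>(2)[OF \<phi>(3)[OF False]] \<phi>_nonneg by (intro mult_left_mono) auto
      finally show ?thesis
        using True by simp
    qed
  next
    case False
    then show ?thesis
      using d[of n] by (simp add: h_def max_def mult.commute)
  qed
  have "d \<longlonglongrightarrow> 0"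
    unfolding d_def by (rule LIMSEQ_inverse_real_of_nat)
  then have unif: "uniform_limit UNIV (\<lambda>n x. \<psi> (max (\<phi> x) (d n)) * \<phi> x) h sequentially"
    by (intro uniform_limitI) (auto dest: order_tendstoD(2) elim!: eventually_mono
        intro: order_le_less_trans[OF dist_le])
  have "continuous_on UNIV (\<lambda>x. apply_bcontfun (bcontfun_mult (a n) b) x)" for n
    by (rule continuous_on_apply_bcontfun)
  then have "continuous_on UNIV h"
    by (intro uniform_limit_theorem[OF _ unif]) (simp_all add: a b)
  then have H: "apply_bcontfun (Bcontfun h) = h"
    by (intro apply_Bcontfun_compact K)
  have "(\<lambda>n. bcontfun_mult (a n) b) \<longlonglongrightarrow> Bcontfun h"
    using unif by (intro uniform_limit_tendsto_bcontfun) (simp add: H a b cong: uniform_limit_cong')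
  then have "Bcontfun h \<in> ?P"
    by (rule closed_sequentially[OF closed mem])
  then obtain u v where uv: "Bcontfun h = bcontfun_mult u v" "v \<in> interval_C \<phi> \<phi>"
    by (auto simp: setprod_C_def)
  \<comment> \<open>The interval from \<phi> to \<phi> contains only \<phi>, so \<open>v\<close> is
    \<phi>.\<close>
  have hu: "h x = u x * \<phi> x" for x
    using arg_cong[OF uv(1), of "\<lambda>w. apply_bcontfun w x"] uv(2)
    by (auto simp: H interval_C_def fun_eq_iff intro: antisym)
  have u: "u x = \<psi> (\<phi> x)" if "0 < \<phi> x" for x
    using hu[of x] that by (simp add: h_def)
  \<comment> \<open>The values 1 and 2 cannot both be within 1/2 of \<open>u p\<close>, yet
    \<open>u\<close> takes both arbitrarily near \<open>p\<close>.\<close>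
  define V where "V = {x. dist (u x) (u p) < 1/2}"
  have "open V" "p \<in> V"
    unfolding V_def
    by (auto intro!: open_Collect_less continuous_intros continuous_on_apply_bcontfun)
  then obtain e where e: "0 < e" "\<And>x. \<phi> x < e \<Longrightarrow> x \<in> V"
    using compact_point_zero_set_nhds[OF K \<phi>(1) \<phi>(3)] by blast
  obtain y z where "0 < \<phi> y" "\<phi> y < e" "\<psi> (\<phi> y) = 1" "0 < \<phi> z" "\<phi> z < e" "\<psi> (\<phi> z) = 2"
    using \<psi>(3)[OF e(1)] \<psi>(4)[OF e(1)] by blast
  then have "dist 1 (u p) < 1/2" "dist 2 (u p) < 1/2"
    using e(2)[of y] e(2)[of z] by (simp_all add: V_def u)
  then show False
    unfolding dist_real_def by linarith
qed

theorem theorem4p1: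
  assumes "compact (UNIV :: 'a :: {first_countable_topology, t2_space} set)"
    and "\<And>A B :: ('a \<Rightarrow>\<^sub>C real) set.
      positive_interval A \<Longrightarrow> continuous_interval A \<Longrightarrow>
      nonnegative_interval B \<Longrightarrow> continuous_interval B \<Longrightarrow>
      closed (setprod_C A B)"
  shows "finite (UNIV :: 'a set)"
proof (rule ccontr)
  assume "infinite (UNIV :: 'a set)"
  then obtain p :: 'a where p: "p islimpt UNIV"
    using Heine_Borel_imp_Bolzano_Weierstrass[OF assms(1)] by blast
  obtain \<phi> :: "'a \<Rightarrow> real" where \<phi>: "continuous_on UNIV \<phi>" "\<phi> p = 0" "\<And>x. x \<noteq> p \<Longrightarrow> 0 < \<phi> x"
    using compact_t2_first_countable_point_zero_set[OF assms(1)] by blast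
  have "bounded (range \<phi>)"
    using assms(1) \<phi>(1) compact_continuous_image compact_imp_bounded by blast
  \<comment> \<open>The second factor is the singleton of \<phi>, which is nonnegative but, because
    of the zero at \<open>p\<close>, not positive.\<close>
  then have B: "represents_interval \<phi> \<phi> (interval_C \<phi> \<phi>)"
    by (simp add: represents_interval_def)
  have A: "represents_interval (\<lambda>_. 1) (\<lambda>_. 2) (interval_C (\<lambda>_::'a. 1) (\<lambda>_. 2))"
    by (simp add: represents_interval_def)
  have "0 \<le> \<phi> x" for x
    using \<phi>(2) \<phi>(3)[of x] by (cases "x = p") auto
  then have "closed (setprod_C (interval_C (\<lambda>_. 1) (\<lambda>_. 2)) (interval_C \<phi> \<phi>))"
    using A B \<phi>(1) unfolding positive_interval_def nonnegative_interval_def continuous_interval_def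
    by (intro assms(2)[unfolded positive_interval_def nonnegative_interval_def continuous_interval_def])
      (blast intro: zero_less_one continuous_on_const)+
  then show False
    using not_closed_setprod_C[OF assms(1) p \<phi>] by blast
qed

end
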